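(* Let $f:\mathbb{R}\to\mathbb{C}$ be such that $f\in L^1(-T,T)$ for all $T>0$ and $$\lim_{T\to\infty}\frac1T\int_{|t|<T}|t f(t)|\,dt=0.$$ Then, uniformly in $x\in\mathbb{R}$, $$\lim_{h\downarrow 0}\left\{\frac{\Delta\mathcal{L}(x;h)}{2h}-I_{1/h}(x)\right\}=0.$$
   Context: For $T>0$ and $x\in\mathbb{R}$, put $I_T(x):=\int_{|t|<T}f(t)e^{itx}\,dt$. For $h>0$ and $x\in\mathbb{R}$, the quantity $\frac{\Delta\mathcal{L}(x;h)}{2h}$ is defined by $$\frac{\Delta\mathcal{L}(x;h)}{2h}:=\int_{\mathbb{R}}f(t)e^{itx}\,\frac{\sin(th)}{th}\,dt,$$ where $\frac{\sin(th)}{th}$ is read as $1$ at $t=0$; under the hypotheses of the claim this integral exists in Lebesgue's sense. (Formally, $\mathcal{L}(x)=\int_{\mathbb{R}}f(t)\frac{e^{itx}}{it}\,dt$ and $\Delta\mathcal{L}(x;h)=\mathcal{L}(x+h)-\mathcal{L}(x-h)$, but the integral defining $\mathcal{L}$ need not exist as a Lebesgue integral; only the displayed definition is used.) *)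

theory Defs
  imports "HOL-Analysis.Analysis" "HOL-Probability.Sinc_Integral"
begin

(* All integrals are with respect to the completed measure lebesgue (not lborel), so f is only
   required to be Lebesgue measurable. *)

definition trunc_fourier :: "(real \<Rightarrow> complex) \<Rightarrow> real \<Rightarrow> real \<Rightarrow> complex" where
  "trunc_fourier f T x =
     (LINT t:{t. \<bar>t\<bar> < T}|lebesgue. f t * exp (\<i> * complex_of_real (t * x)))"

(* For h > 0, t * h vanishes only at t = 0, where the library function sinc takes the value 1. *)
definition diff_integrand :: "(real \<Rightarrow> complex) \<Rightarrow> real \<Rightarrow> real \<Rightarrow> real \<Rightarrow> complex" where
  "diff_integrand f x h t =
     f t * exp (\<i> * complex_of_real (t * x)) * complex_of_real (sinc (t * h))"

(* The symmetric difference quotient written as Delta L(x;h) / (2h), with L(x) formally the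
   integral of f(t) e^(itx) / (it). *)
definition diff_quot :: "(real \<Rightarrow> complex) \<Rightarrow> real \<Rightarrow> real \<Rightarrow> complex" where
  "diff_quot f x h = (LINT t|lebesgue. diff_integrand f x h t)"

end

theory Submission
  imports Defs
begin

text \<open>
  Let \<open>G(S)\<close> be the integral of \<open>|t f(t)|\<close> over \<open>|t| < S\<close>. The difference in question is the integral
  of \<open>f(t) e\<^sup>i\<^sup>t\<^sup>x\<close> against \<open>sinc(th) - 1[|t| < 1/h]\<close>, and this kernel is at most \<open>4 h |t| / 4^k\<close> on the
  dyadic shell ending at \<open>|t| = 2^k / h\<close> (from \<open>|sinc u - 1| \<le> |u|\<close> near the origin and
  \<open>|sinc u| \<le> 1 / |u|\<close> away from it). If \<open>G(S) \<le> e S\<close> for all \<open>S \<ge> 1/h\<close>, summing the shells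
  bounds the difference by the sum of \<open>4 h 4^-k e 2^k / h\<close>, which is \<open>8 e\<close>, independently of \<open>x\<close>.
\<close>

section \<open>Pointwise bounds for the sinc kernel\<close>

text \<open>Taylor's formula of order two gives |sin u - u| <= u^2 / 2; division by |u| leaves |u| /
  2, weakened to |u|.\<close>

lemma abs_sinc_minus_1_le:
  fixes u :: real
  shows "\<bar>sinc u - 1\<bar> \<le> \<bar>u\<bar>"
proof (cases "u = 0")
  case False
  have "\<bar>sin u - (\<Sum>m<2. sin_coeff m * u ^ m)\<bar> \<le> inverse (fact 2) * \<bar>u\<bar> ^ 2"
    by (rule Maclaurin_sin_bound)
  moreover have "(\<Sum>m<2. sin_coeff m * u ^ m) = u"
    by (simp add: numeral_2_eq_2 sin_coeff_def)
  ultimately have "2 * \<bar>sin u - u\<bar> \<le> \<bar>u\<bar> * \<bar>u\<bar>"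
    by (simp add: power2_eq_square)
  then have "\<bar>sin u - u\<bar> \<le> \<bar>u\<bar> * \<bar>u\<bar>"
    by (rule order_trans[rotated]) simp
  moreover have "sinc u - 1 = (sin u - u) / u"
    using False by (simp add: field_simps)
  ultimately show ?thesis
    using False by (simp add: abs_divide pos_divide_le_eq)
qed simp

text \<open>For w = |t| h < 1 take k = 0. Otherwise the indicator vanishes and the least k with w <
  2^k satisfies 2^k <= 2 w, hence 4^k <= 4 w^2 and 1 / w <= 4 w / 4^k; this is the source of the
  factor 4.\<close>

lemma dyadic_kernel_bound:
  fixes t h :: real
  assumes "h > 0"
  obtains k :: nat where "\<bar>t\<bar> < 2 ^ k / h"
    and "\<bar>sinc (t * h) - indicator {t. \<bar>t\<bar> < 1 / h} t\<bar> \<le> 4 * h / 4 ^ k * \<bar>t\<bar>"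
proof (cases "\<bar>t\<bar> < 1 / h")
  case True
  have "\<bar>sinc (t * h) - 1\<bar> \<le> \<bar>t * h\<bar>"
    by (rule abs_sinc_minus_1_le)
  also have "\<dots> \<le> 4 * h * \<bar>t\<bar>"
    using assms by (simp add: abs_mult)
  finally show ?thesis
    using True by (intro that[of 0]) simp_all
next
  case False
  define w where "w = \<bar>t\<bar> * h"
  have w: "1 \<le> w"
    using False assms by (simp add: w_def field_simps)
  define n where "n = (LEAST n. w < 2 ^ n)"
  have "\<exists>n. w < 2 ^ n"
    using real_arch_pow[of 2 w] by simp
  then have n: "w < 2 ^ n"
    unfolding n_def by (rule LeastI_ex)
  \<comment> \<open>Since w >= 1 = 2^0, the least exponent is positive; minimality then applies to
    its predecessor.\<close>
  then obtain m where m: "n = Suc m"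
    using w by (cases n) auto
  have "2 ^ m \<le> w"
    using not_less_Least[of m "\<lambda>n. w < 2 ^ n"] m unfolding n_def by (simp add: not_less)
  then have "(2 ^ m) ^ 2 \<le> w ^ 2"
    by (intro power_mono) auto
  moreover have "((2::real) ^ m) ^ 2 = 4 ^ m"
    by (simp add: power2_eq_square flip: power_mult_distrib)
  ultimately have "4 ^ m \<le> w * w"
    by (simp add: power2_eq_square)
  then have "1 / w \<le> 4 / 4 ^ n * w"
    using w m by (simp add: field_simps)
  moreover have "\<bar>sinc (t * h)\<bar> \<le> 1 / w"
  proof -
    have "t * h \<noteq> 0" "\<bar>t * h\<bar> = w"
      using w assms by (auto simp: w_def abs_mult)
    then show ?thesis
      using w by (simp add: abs_divide divide_right_mono)
  qed
  ultimately have "\<bar>sinc (t * h)\<bar> \<le> 4 / 4 ^ n * w"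
    by (rule order_trans[rotated])
  also have "4 / 4 ^ n * w = 4 * h / 4 ^ n * \<bar>t\<bar>"
    by (simp add: w_def)
  finally show ?thesis
    using n False assms by (intro that[of n]) (simp_all add: w_def pos_less_divide_eq)
qed

section \<open>Measurability and local integrability\<close>

text \<open>At each point the truncations of \<open>f\<close> to growing intervals eventually equal
  \<open>f\<close>, so \<open>f\<close> is a pointwise limit of measurable functions.\<close>

lemma borel_measurable_locally_integrable:
  fixes f :: "real \<Rightarrow> 'a :: {banach, second_countable_topology}"
  assumes "\<And>T. T > 0 \<Longrightarrow> set_integrable lebesgue {-T<..<T} f"
  shows "f \<in> borel_measurable lebesgue"
proof (rule borel_measurable_LIMSEQ_metric)
  fix n
  show "(\<lambda>t. indicator {- real (Suc n)<..<real (Suc n)} t *\<^sub>R f t) \<in> borel_measurable lebesgue"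
    using assms[of "real (Suc n)"] unfolding set_integrable_def by auto
next
  fix t :: real
  obtain N where N: "\<bar>t\<bar> < real N"
    using reals_Archimedean2 by blast
  have "\<forall>\<^sub>F n in sequentially. indicator {- real (Suc n)<..<real (Suc n)} t *\<^sub>R f t = f t"
    using eventually_ge_at_top[of N] by eventually_elim (use N in \<open>auto simp: indicator_def\<close>)
  then show "(\<lambda>n. indicator {- real (Suc n)<..<real (Suc n)} t *\<^sub>R f t) \<longlonglongrightarrow> f t"
    by (rule tendsto_eventually)
qed

lemma abs_less_eq_greaterThanLessThan: "{t::real. \<bar>t\<bar> < S} = {-S<..<S}"
  by auto

text \<open>On |t| < S the function S |f| dominates |t f|. This makes the integral of |t f| genuine:
  a non-integrable function would get the default value 0, and a bound on it would carry no
  information.\<close>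

lemma set_integrable_norm_times_self:
  fixes f :: "real \<Rightarrow> complex"
  assumes "set_integrable lebesgue {-S<..<S} f" "f \<in> borel_measurable lebesgue"
  shows "set_integrable lebesgue {t. \<bar>t\<bar> < S} (\<lambda>t. norm (complex_of_real t * f t))"
  unfolding set_integrable_def abs_less_eq_greaterThanLessThan
proof (rule Bochner_Integration.integrable_bound)
  note [measurable] = assms(2) id_borel_measurable_lebesgue[unfolded id_def]
  show "integrable lebesgue (\<lambda>t. S *\<^sub>R (indicator {-S<..<S} t *\<^sub>R f t))"
    using assms(1) unfolding set_integrable_def by (intro integrable_scaleR_right)
  show "AE t in lebesgue. norm (indicator {-S<..<S} t *\<^sub>R norm (complex_of_real t * f t))
          \<le> norm (S *\<^sub>R (indicator {-S<..<S} t *\<^sub>R f t))"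
    by (auto simp: indicator_def norm_mult intro!: mult_right_mono)
  show "(\<lambda>t. indicator {-S<..<S} t *\<^sub>R norm (complex_of_real t * f t)) \<in> borel_measurable lebesgue"
    by measurable
qed

section \<open>Summation over dyadic scales\<close>

text \<open>For nonnegative extended integrals, sum and integral commute without a convergence
  check. Applying \<open>G\<close> at S = 2^k / h bounds term k by 4 e / 2^k. Whole intervals
  replace shells, since their overlap does not affect this bound.\<close>

lemma nn_integral_dyadic_majorant_le:
  fixes f :: "real \<Rightarrow> complex"
  assumes loc: "\<And>T. T > 0 \<Longrightarrow> set_integrable lebesgue {-T<..<T} f"
    and h: "h > 0" and e: "e \<ge> 0"
    and G: "\<And>S. S \<ge> 1 / h \<Longrightarrow>
              (LINT t:{t. \<bar>t\<bar> < S}|lebesgue. norm (complex_of_real t * f t)) \<le> e * S"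
  shows "(\<integral>\<^sup>+t. (\<Sum>k. ennreal (4 * h / 4 ^ k *
            (indicator {t. \<bar>t\<bar> < 2 ^ k / h} t *\<^sub>R norm (complex_of_real t * f t)))) \<partial>lebesgue)
          \<le> ennreal (8 * e)"
proof -
  define g where "g k t = indicator {t. \<bar>t\<bar> < 2 ^ k / h} t *\<^sub>R norm (complex_of_real t * f t)"
    for k :: nat and t
  have f: "f \<in> borel_measurable lebesgue"
    by (rule borel_measurable_locally_integrable[OF loc])
  have g: "integrable lebesgue (g k)" for k
    using set_integrable_norm_times_self[OF loc f, of "2 ^ k / h"] h
    unfolding g_def set_integrable_def by simp
  have gnn: "g k t \<ge> 0" for k t
    by (simp add: g_def)
  have gint: "(LINT t|lebesgue. g k t) \<le> e * (2 ^ k / h)" for k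
    using G[of "2 ^ k / h"] h by (simp add: g_def set_lebesgue_integral_def divide_right_mono)
  have "(\<integral>\<^sup>+t. (\<Sum>k. ennreal (4 * h / 4 ^ k * g k t)) \<partial>lebesgue)
      = (\<Sum>k. \<integral>\<^sup>+t. ennreal (4 * h / 4 ^ k * g k t) \<partial>lebesgue)"
    using g by (intro nn_integral_suminf) (auto intro!: borel_measurable_times)
  also have "\<dots> \<le> (\<Sum>k. ennreal (4 * e * (1 / 2) ^ k))"
  proof (intro suminf_le allI)
    fix k
    have "(\<integral>\<^sup>+t. ennreal (4 * h / 4 ^ k * g k t) \<partial>lebesgue)
        = ennreal (4 * h / 4 ^ k * (LINT t|lebesgue. g k t))"
      using g h gnn by (subst nn_integral_eq_integral) auto
    also have "\<dots> \<le> ennreal (4 * h / 4 ^ k * (e * (2 ^ k / h)))"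
      using h by (intro ennreal_leI mult_left_mono gint) auto
    also have "4 * h / 4 ^ k * (e * (2 ^ k / h)) = 4 * e * (1 / 2) ^ k"
    proof -
      have "(4::real) ^ k = 2 ^ k * 2 ^ k"
        by (simp flip: power_mult_distrib)
      then show ?thesis
        using h by (simp add: field_simps)
    qed
    finally show "(\<integral>\<^sup>+t. ennreal (4 * h / 4 ^ k * g k t) \<partial>lebesgue)
        \<le> ennreal (4 * e * (1 / 2) ^ k)" .
  qed auto
  also have "\<dots> = ennreal (8 * e)"
  proof -
    have "(\<lambda>k. 4 * e * (1 / 2) ^ k) sums (4 * e * (1 / (1 - 1 / 2)))"
      by (intro sums_mult geometric_sums) auto
    then show ?thesis
      using e by (intro suminf_ennreal_eq) auto
  qed
  finally show ?thesis
    by (simp add: g_def)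
qed

text \<open>The constant \<open>e\<close> is left free: any finite value yields integrability, small
  values yield the limit.\<close>

lemma diff_quot_minus_trunc_fourier_le:
  fixes f :: "real \<Rightarrow> complex"
  assumes loc: "\<And>T. T > 0 \<Longrightarrow> set_integrable lebesgue {-T<..<T} f"
    and h: "h > 0" and e: "e \<ge> 0"
    and G: "\<And>S. S \<ge> 1 / h \<Longrightarrow>
              (LINT t:{t. \<bar>t\<bar> < S}|lebesgue. norm (complex_of_real t * f t)) \<le> e * S"
  shows "integrable lebesgue (diff_integrand f x h)"
    and "norm (diff_quot f x h - trunc_fourier f (1 / h) x) \<le> 8 * e"
proof -
  have [measurable]: "f \<in> borel_measurable lebesgue"
    by (rule borel_measurable_locally_integrable[OF loc])
  have exp_meas [measurable]: "(\<lambda>t. exp (\<i> * complex_of_real (t * x))) \<in> borel_measurable lebesgue"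
    by (intro measurable_completion) (auto intro!: borel_measurable_continuous_onI continuous_intros)
  have sinc_meas [measurable]: "(\<lambda>t. sinc (t * h)) \<in> borel_measurable lebesgue"
    by (intro measurable_completion) simp
  \<comment> \<open>\<open>A\<close> is the integrand of the truncated integral and \<open>D\<close>
    the remainder. The full integrand is shown integrable only as their sum.\<close>
  define A where "A t = indicator {t. \<bar>t\<bar> < 1 / h} t *\<^sub>R (f t * exp (\<i> * complex_of_real (t * x)))" for t
  define D where "D t = f t * exp (\<i> * complex_of_real (t * x)) *
      complex_of_real (sinc (t * h) - indicator {t. \<bar>t\<bar> < 1 / h} t)" for t
  have [measurable]: "{t::real. \<bar>t\<bar> < 1 / h} \<in> sets lebesgue"
    by (simp add: abs_less_eq_greaterThanLessThan)
  have A: "integrable lebesgue A"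
  proof (rule Bochner_Integration.integrable_bound)
    show "integrable lebesgue (\<lambda>t. indicator {-(1 / h)<..<1 / h} t *\<^sub>R f t)"
      using loc[of "1 / h"] h unfolding set_integrable_def by simp
    show "A \<in> borel_measurable lebesgue"
      unfolding A_def by measurable
    show "AE t in lebesgue. norm (A t) \<le> norm (indicator {-(1 / h)<..<1 / h} t *\<^sub>R f t)"
      by (auto simp: A_def norm_mult abs_less_eq_greaterThanLessThan)
  qed
  have Dm: "D \<in> borel_measurable lebesgue"
    unfolding D_def by measurable
  have "(\<integral>\<^sup>+t. ennreal (norm (D t)) \<partial>lebesgue)
      \<le> (\<integral>\<^sup>+t. (\<Sum>k. ennreal (4 * h / 4 ^ k *
            (indicator {t. \<bar>t\<bar> < 2 ^ k / h} t *\<^sub>R norm (complex_of_real t * f t)))) \<partial>lebesgue)"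
  proof (rule nn_integral_mono)
    fix t :: real
    define a where "a k = ennreal (4 * h / 4 ^ k *
            (indicator {t. \<bar>t\<bar> < 2 ^ k / h} t *\<^sub>R norm (complex_of_real t * f t)))" for k :: nat
    obtain k :: nat where k: "\<bar>t\<bar> < 2 ^ k / h"
      "\<bar>sinc (t * h) - indicator {t. \<bar>t\<bar> < 1 / h} t\<bar> \<le> 4 * h / 4 ^ k * \<bar>t\<bar>"
      using dyadic_kernel_bound[OF h] by blast
    have "norm (D t) = norm (f t) * \<bar>sinc (t * h) - indicator {t. \<bar>t\<bar> < 1 / h} t\<bar>"
      unfolding D_def norm_mult norm_of_real by simp
    also have "\<dots> \<le> norm (f t) * (4 * h / 4 ^ k * \<bar>t\<bar>)"
      by (intro mult_left_mono k) auto
    finally have "ennreal (norm (D t)) \<le> a k"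
      unfolding a_def using k(1) by (intro ennreal_leI) (simp add: norm_mult mult_ac)
    \<comment> \<open>A single suitable term already dominates, so no partition into shells is
      required.\<close>
    also have "a k \<le> (\<Sum>k. a k)"
      using sum_le_suminf[of a "{k}"] by simp
    finally show "ennreal (norm (D t)) \<le> (\<Sum>k. ennreal (4 * h / 4 ^ k *
            (indicator {t. \<bar>t\<bar> < 2 ^ k / h} t *\<^sub>R norm (complex_of_real t * f t))))"
      by (simp add: a_def)
  qed
  also have "\<dots> \<le> ennreal (8 * e)"
    by (rule nn_integral_dyadic_majorant_le[OF loc h e G])
  finally have D_le: "(\<integral>\<^sup>+t. ennreal (norm (D t)) \<partial>lebesgue) \<le> ennreal (8 * e)" .
  then have D: "integrable lebesgue D"
    by (intro integrableI_bounded Dm) (auto intro: le_less_trans)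
  have split: "diff_integrand f x h = (\<lambda>t. D t + A t)"
    by (auto simp: diff_integrand_def D_def A_def fun_eq_iff indicator_def algebra_simps)
  show "integrable lebesgue (diff_integrand f x h)"
    unfolding split using D A by (rule Bochner_Integration.integrable_add)
  have "diff_quot f x h - trunc_fourier f (1 / h) x = (LINT t|lebesgue. D t)"
    unfolding diff_quot_def split Bochner_Integration.integral_add[OF D A]
    by (simp add: trunc_fourier_def set_lebesgue_integral_def A_def[abs_def])
  then have "ennreal (norm (diff_quot f x h - trunc_fourier f (1 / h) x)) \<le> ennreal (8 * e)"
    using integral_norm_bound_ennreal[OF D] D_le by simp
  then show "norm (diff_quot f x h - trunc_fourier f (1 / h) x) \<le> 8 * e"
    using e by simp
qed

section \<open>Integrability for every h and the uniform limit\<close>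

theorem mainTheorem1:
  fixes f :: "real \<Rightarrow> complex"
  assumes "\<And>T::real. T > 0 \<Longrightarrow> set_integrable lebesgue {-T<..<T} f"
    and "((\<lambda>T::real. (1 / T) * (LINT t:{t. \<bar>t\<bar> < T}|lebesgue. norm (complex_of_real t * f t)))
           \<longlongrightarrow> 0) at_top"
  shows "(\<forall>h>0. \<forall>x. integrable lebesgue (diff_integrand f x h)) \<and>
         uniform_limit UNIV
           (\<lambda>h x. diff_quot f x h - trunc_fourier f (1 / h) x) (\<lambda>x. 0) (at_right 0)"
proof -
  define G where "G S = (LINT t:{t. \<bar>t\<bar> < S}|lebesgue. norm (complex_of_real t * f t))" for S
  have f: "f \<in> borel_measurable lebesgue"
    by (rule borel_measurable_locally_integrable[OF assms(1)])
  have G_mono: "G S \<le> G S'" if "0 < S" "S \<le> S'" for S S'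
    unfolding G_def set_lebesgue_integral_def
    using set_integrable_norm_times_self[OF assms(1) f, of S]
      set_integrable_norm_times_self[OF assms(1) f, of S'] that
    by (intro integral_mono) (auto simp: set_integrable_def indicator_def)
  have G_nonneg: "G S \<ge> 0" for S
    unfolding G_def set_lebesgue_integral_def by (intro Bochner_Integration.integral_nonneg) auto
  have small: "\<exists>T>0. \<forall>S\<ge>T. G S \<le> e * S" if "e > 0" for e
  proof -
    have "\<forall>\<^sub>F S in at_top. (1 / S) * G S < e"
      using order_tendstoD(2)[OF assms(2) that] by (simp add: G_def)
    then obtain T where T: "\<And>S. S \<ge> T \<Longrightarrow> (1 / S) * G S < e"
      unfolding eventually_at_top_linorder by blast
    \<comment> \<open>The maximum with 1 keeps \<open>S\<close> positive, so that the division by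
      \<open>S\<close> can be cleared.\<close>
    have "G S \<le> e * S" if "S \<ge> max T 1" for S
      using T[of S] that by (simp add: field_simps)
    then show ?thesis
      by (intro exI[of _ "max T 1"]) auto
  qed
  have "integrable lebesgue (diff_integrand f x h)" if h: "h > 0" for h x
  proof -
    obtain T where T: "T > 0" "\<And>S. S \<ge> T \<Longrightarrow> G S \<le> 1 * S"
      using small[of 1] by auto
    \<comment> \<open>Here \<open>h\<close> need not be small, so 1 / h may lie below
      \<open>T\<close>. For S < T monotonicity gives G S <= G T, and 1 <= h S turns this constant
      into a multiple of \<open>S\<close>.\<close>
    have "G S \<le> (1 + G T * h) * S" if S: "S \<ge> 1 / h" for S
    proof -
      have hS: "S > 0" "1 \<le> h * S"
        using S h by (auto simp: field_simps intro: less_le_trans[of 0 "1 / h"])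
      have "G T * 1 \<le> G T * (h * S)"
        using hS G_nonneg by (intro mult_left_mono) auto
      moreover have "G S \<le> S + G T"
        using T(2)[of S] G_mono[of S T] hS G_nonneg[of T] by (cases "S \<ge> T") auto
      ultimately show ?thesis
        by (simp add: algebra_simps)
    qed
    then show ?thesis
      using h G_nonneg[of T] unfolding G_def
      by (intro diff_quot_minus_trunc_fourier_le(1)[OF assms(1) h,
            where e = "1 + G T * h"]) (auto simp: G_def)
  qed
  moreover have "uniform_limit UNIV
      (\<lambda>h x. diff_quot f x h - trunc_fourier f (1 / h) x) (\<lambda>x. 0) (at_right 0)"
  proof (rule uniform_limitI)
    fix e :: real
    assume e: "e > 0"
    \<comment> \<open>With e / 16 the factor 8 gives e / 2, strictly below \<open>e\<close>. For h <
      1 / T every S >= 1 / h exceeds \<open>T\<close>, and \<open>T\<close> does not depend on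
      \<open>x\<close>.\<close>
    then obtain T where T: "T > 0" "\<And>S. S \<ge> T \<Longrightarrow> G S \<le> e / 16 * S"
      using small[of "e / 16"] by auto
    have "\<forall>\<^sub>F h in at_right 0. h \<in> {0<..<1 / T}"
      using T(1) by (intro eventually_at_right_real) simp
    then show "\<forall>\<^sub>F h in at_right 0.
        \<forall>x\<in>UNIV. dist (diff_quot f x h - trunc_fourier f (1 / h) x) 0 < e"
    proof eventually_elim
      case (elim h)
      then have "h > 0" "T \<le> 1 / h"
        using T(1) by (auto simp: field_simps)
      then have "norm (diff_quot f x h - trunc_fourier f (1 / h) x) \<le> 8 * (e / 16)" for x
        using T(2) e by (intro diff_quot_minus_trunc_fourier_le(2)[OF assms(1)]) (auto simp: G_def)
      moreover have "8 * (e / 16) < e"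
        using e by simp
      ultimately show ?case
        unfolding dist_norm diff_0_right by (blast intro: le_less_trans)
    qed
  qed
  ultimately show ?thesis
    by blast
qed

end
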